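(* There exist TRS that have a quasi-interpretation in $\mathsf{MaxPoly}\{\mathbb{R}^+\}$ but have no quasi-interpretation in $\mathsf{MaxPoly}\{\mathbb{Q}^+\}$.
   Context: A constructor TRS consists of disjoint sets $\mathcal{C}$ (constructors) and $\mathcal{D}$ (defined symbols) with fixed arities, variables, and finitely many rules $l\to r$ with $l=\mathtt{f}(t_1,\dots,t_n)$, $\mathtt{f}\in\mathcal{D}$, $t_i$ built from constructors and variables, variables of $r$ occurring in $l$; throughout, TRS are orthogonal constructor TRS. For $\mathbb{K}\in\{\mathbb{Q}^+,\mathbb{R}^+\}$ (nonnegative rationals/reals), $\mathsf{MaxPoly}\{\mathbb{K}\}$ is the set of functions obtained from constants and variables ranging over $\mathbb{K}$ by compositions of $+$, $\times$, $\max$. An assignment over $\mathbb{K}$ maps each symbol of arity $m$ to a function $\mathbb{K}^m\to\mathbb{K}$, extended homomorphically to terms. A quasi-interpretation is an assignment whose functions are nondecreasing in each argument, with $(\!|l|\!)\geq(\!|r|\!)$ for every rule (for all variable values in $\mathbb{K}$) and $(\!|\mathtt{g}|\!)(X_1,\dots,X_m)\geq X_i$ for every symbol $\mathtt{g}$ of arity $m$ and every $i$.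
   Formalization: Quasi-interpretations are additionally required, over both R+ and Q+, to be additive: each constructor of positive arity is the sum of its arguments plus a constant at least 1; without this, taking the maximum of the arguments is a quasi-interpretation in MaxPoly{Q+} of every TRS. *)

theory Defs
  imports Complex_Main
begin

datatype (funs: 'f, vars: 'v) trm = Var 'v | Fun 'f "('f, 'v) trm list"

primrec subst :: "('v \<Rightarrow> ('f, 'w) trm) \<Rightarrow> ('f, 'v) trm \<Rightarrow> ('f, 'w) trm" where
  "subst \<sigma> (Var x) = \<sigma> x"
| "subst \<sigma> (Fun f ts) = Fun f (map (subst \<sigma>) ts)"

fun subterms :: "('f, 'v) trm \<Rightarrow> ('f, 'v) trm set" where
  "subterms (Var x) = {Var x}"
| "subterms (Fun f ts) = insert (Fun f ts) (\<Union>t\<in>set ts. subterms t)"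

fun var_list :: "('f, 'v) trm \<Rightarrow> 'v list" where
  "var_list (Var x) = [x]"
| "var_list (Fun f ts) = concat (map var_list ts)"

definition linear :: "('f, 'v) trm \<Rightarrow> bool" where
  "linear t \<longleftrightarrow> distinct (var_list t)"

inductive_set terms :: "'f set \<Rightarrow> ('f \<Rightarrow> nat) \<Rightarrow> ('f, 'v) trm set"
  for F :: "'f set" and ar :: "'f \<Rightarrow> nat" where
  Var: "Var x \<in> terms F ar"
| Fun: "\<lbrakk>f \<in> F; length ts = ar f; \<And>t. t \<in> set ts \<Longrightarrow> t \<in> terms F ar\<rbrakk> \<Longrightarrow> Fun f ts \<in> terms F ar"

record ('f, 'v) trs =
  constructors :: "'f set"
  defined :: "'f set"
  arity :: "'f \<Rightarrow> nat"
  rules :: "(('f, 'v) trm \<times> ('f, 'v) trm) set"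

definition symbols :: "('f, 'v) trs \<Rightarrow> 'f set" where
  "symbols T = constructors T \<union> defined T"

definition constructor_trs :: "('f, 'v) trs \<Rightarrow> bool" where
  "constructor_trs T \<longleftrightarrow>
     constructors T \<inter> defined T = {} \<and>
     finite (rules T) \<and>
     (\<forall>(l, r)\<in>rules T.
        (\<exists>f ts. l = Fun f ts \<and> f \<in> defined T \<and> length ts = arity T f \<and>
                set ts \<subseteq> terms (constructors T) (arity T)) \<and>
        r \<in> terms (symbols T) (arity T) \<and>
        vars r \<subseteq> vars l)"

definition left_linear :: "('f, 'v) trs \<Rightarrow> bool" where
  "left_linear T \<longleftrightarrow> (\<forall>(l, r)\<in>rules T. linear l)"

text \<open>Two independent substitutions play the role of renaming the rules apart. A proper subterm
  of \<open>l1\<close> is never equal to \<open>l1\<close>, so the excluded case is exactly the overlap of a rule with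
  itself at the root.\<close>

definition non_overlapping :: "('f, 'v) trs \<Rightarrow> bool" where
  "non_overlapping T \<longleftrightarrow>
     (\<forall>(l1, r1)\<in>rules T. \<forall>(l2, r2)\<in>rules T. \<forall>s\<in>subterms l1.
        \<forall>\<sigma> \<tau> :: 'v \<Rightarrow> ('f, 'v) trm.
          (\<nexists>x. s = Var x) \<and> subst \<sigma> s = subst \<tau> l2 \<longrightarrow> s = l1 \<and> (l1, r1) = (l2, r2))"

definition orthogonal :: "('f, 'v) trs \<Rightarrow> bool" where
  "orthogonal T \<longleftrightarrow> left_linear T \<and> non_overlapping T"

definition nonneg_reals :: "real set" where
  "nonneg_reals = {x. 0 \<le> x}"

definition nonneg_rats :: "real set" where
  "nonneg_rats = {x \<in> \<rat>. 0 \<le> x}"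

definition tuples :: "'a set \<Rightarrow> nat \<Rightarrow> 'a list set" where
  "tuples K m = {xs. length xs = m \<and> set xs \<subseteq> K}"

text \<open>An \<open>m\<close>-ary function on \<open>K\<close> is represented by a function on lists. Only its values
  on \<open>tuples K m\<close> are ever used.\<close>

inductive_set max_poly :: "real set \<Rightarrow> nat \<Rightarrow> (real list \<Rightarrow> real) set"
  for K :: "real set" and m :: nat where
  const: "c \<in> K \<Longrightarrow> (\<lambda>xs. c) \<in> max_poly K m"
| var: "i < m \<Longrightarrow> (\<lambda>xs. xs ! i) \<in> max_poly K m"
| add: "\<lbrakk>p \<in> max_poly K m; q \<in> max_poly K m\<rbrakk> \<Longrightarrow> (\<lambda>xs. p xs + q xs) \<in> max_poly K m"
| mult: "\<lbrakk>p \<in> max_poly K m; q \<in> max_poly K m\<rbrakk> \<Longrightarrow> (\<lambda>xs. p xs * q xs) \<in> max_poly K m"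
| max: "\<lbrakk>p \<in> max_poly K m; q \<in> max_poly K m\<rbrakk> \<Longrightarrow> (\<lambda>xs. max (p xs) (q xs)) \<in> max_poly K m"

definition assignment :: "real set \<Rightarrow> ('f, 'v) trs \<Rightarrow> ('f \<Rightarrow> real list \<Rightarrow> real) \<Rightarrow> bool" where
  "assignment K T A \<longleftrightarrow> (\<forall>g\<in>symbols T. \<forall>xs\<in>tuples K (arity T g). A g xs \<in> K)"

definition in_max_poly :: "real set \<Rightarrow> ('f, 'v) trs \<Rightarrow> ('f \<Rightarrow> real list \<Rightarrow> real) \<Rightarrow> bool" where
  "in_max_poly K T A \<longleftrightarrow> (\<forall>g\<in>symbols T. A g \<in> max_poly K (arity T g))"

primrec interp :: "('f \<Rightarrow> real list \<Rightarrow> real) \<Rightarrow> ('v \<Rightarrow> real) \<Rightarrow> ('f, 'v) trm \<Rightarrow> real" where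
  "interp A \<rho> (Var x) = \<rho> x"
| "interp A \<rho> (Fun f ts) = A f (map (interp A \<rho>) ts)"

definition nondecreasing :: "real set \<Rightarrow> nat \<Rightarrow> (real list \<Rightarrow> real) \<Rightarrow> bool" where
  "nondecreasing K m F \<longleftrightarrow>
     (\<forall>xs\<in>tuples K m. \<forall>i<m. \<forall>y\<in>K. xs ! i \<le> y \<longrightarrow> F xs \<le> F (xs[i := y]))"

definition subterm_property :: "real set \<Rightarrow> nat \<Rightarrow> (real list \<Rightarrow> real) \<Rightarrow> bool" where
  "subterm_property K m F \<longleftrightarrow> (\<forall>xs\<in>tuples K m. \<forall>i<m. F xs \<ge> xs ! i)"

definition quasi_interpretation ::
    "real set \<Rightarrow> ('f, 'v) trs \<Rightarrow> ('f \<Rightarrow> real list \<Rightarrow> real) \<Rightarrow> bool" where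
  "quasi_interpretation K T A \<longleftrightarrow>
     assignment K T A \<and>
     (\<forall>g\<in>symbols T. nondecreasing K (arity T g) (A g)) \<and>
     (\<forall>(l, r)\<in>rules T. \<forall>\<rho>. range \<rho> \<subseteq> K \<longrightarrow> interp A \<rho> l \<ge> interp A \<rho> r) \<and>
     (\<forall>g\<in>symbols T. subterm_property K (arity T g) (A g))"

text \<open>Additivity is the usual normalisation of quasi-interpretations: a constructor of positive
  arity is interpreted by the sum of its arguments plus a constant that is at least 1. Without it,
  interpreting every symbol by the maximum of its arguments is a quasi-interpretation of
  every constructor system; see \<open>max_quasi_interpretation\<close> below.\<close>

definition additive_constructors :: "real set \<Rightarrow> ('f, 'v) trs \<Rightarrow> ('f \<Rightarrow> real list \<Rightarrow> real) \<Rightarrow> bool" where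
  "additive_constructors K T A \<longleftrightarrow>
     (\<forall>c\<in>constructors T. arity T c > 0 \<longrightarrow>
        (\<exists>\<alpha>\<in>K. \<alpha> \<ge> 1 \<and> (\<forall>xs\<in>tuples K (arity T c). A c xs = sum_list xs + \<alpha>)))"

fun maxn :: "nat \<Rightarrow> real list \<Rightarrow> real" where
  "maxn 0 xs = 0"
| "maxn (Suc n) xs = max (maxn n xs) (xs ! n)"

lemma maxn_max_poly:
  assumes "0 \<in> K" and "n \<le> m"
  shows "maxn n \<in> max_poly K m"
  using assms(2)
proof (induction n)
  case 0
  have "maxn 0 = (\<lambda>xs. 0)" by auto
  then show ?case using max_poly.const[OF assms(1)] by simp
next
  case (Suc n)
  have "maxn (Suc n) = (\<lambda>xs. max (maxn n xs) (xs ! n))" by auto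
  moreover have "maxn n \<in> max_poly K m" "(\<lambda>xs. xs ! n) \<in> max_poly K m"
    using Suc by (simp_all add: max_poly.var)
  ultimately show ?case by (simp only: max_poly.max)
qed

lemma maxn_le: "maxn n xs \<le> b \<longleftrightarrow> 0 \<le> b \<and> (\<forall>i<n. xs ! i \<le> b)"
  by (induction n) (auto simp: less_Suc_eq)

lemma maxn_in:
  assumes "0 \<in> K" and "\<And>i. i < n \<Longrightarrow> xs ! i \<in> K"
  shows "maxn n xs \<in> K"
  using assms(2) by (induction n) (auto simp: max_def assms(1))

lemma interp_maxn_le:
  fixes t :: "('f, 'v) trm"
  assumes "t \<in> terms F ar"
  shows "interp (\<lambda>g. maxn (ar g)) \<rho> t \<le> b \<longleftrightarrow>
           (t \<in> range Var \<or> 0 \<le> b) \<and> (\<forall>x\<in>vars t. \<rho> x \<le> b)"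
  using assms
proof induction
  case (Fun f ts)
  have "maxn (ar f) (map (interp (\<lambda>g. maxn (ar g)) \<rho>) ts) \<le> b \<longleftrightarrow>
        0 \<le> b \<and> (\<forall>t\<in>set ts. interp (\<lambda>g. maxn (ar g)) \<rho> t \<le> b)"
    using Fun(2) by (auto simp: maxn_le all_set_conv_all_nth)
  then show ?case using Fun by auto
qed simp

lemma terms_mono: "t \<in> terms F ar \<Longrightarrow> F \<subseteq> G \<Longrightarrow> t \<in> terms G ar"
  by (induction rule: terms.induct) (auto intro: terms.intros)

lemma max_quasi_interpretation:
  fixes T :: "('f, 'v) trs"
  assumes T: "constructor_trs T" and K: "0 \<in> K" "\<And>x. x \<in> K \<Longrightarrow> 0 \<le> x"
  shows "\<exists>A. in_max_poly K T A \<and> quasi_interpretation K T A"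
proof (intro exI conjI)
  let ?A = "\<lambda>g. maxn (arity T g)"
  show "in_max_poly K T ?A"
    using K(1) by (simp add: in_max_poly_def maxn_max_poly)
  have mono: "nondecreasing K m (maxn m)" for m
  proof -
    have "maxn m xs \<le> maxn m (xs[i := y])"
      if "xs \<in> tuples K m" "i < m" "xs ! i \<le> y" for xs i y
    proof -
      have *: "0 \<le> maxn m (xs[i := y]) \<and> (\<forall>j<m. xs[i := y] ! j \<le> maxn m (xs[i := y]))"
        using maxn_le[of m "xs[i := y]" "maxn m (xs[i := y])"] by blast
      have "xs ! j \<le> maxn m (xs[i := y])" if "j < m" for j
      proof -
        have "xs ! j \<le> xs[i := y] ! j"
          using that \<open>xs \<in> _\<close> \<open>xs ! i \<le> y\<close> by (cases "i = j") (auto simp: tuples_def)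
        with * that show ?thesis by (meson order_trans)
      qed
      with * show ?thesis by (simp add: maxn_le)
    qed
    then show ?thesis by (auto simp: nondecreasing_def)
  qed
  have sub: "subterm_property K m (maxn m)" for m
    unfolding subterm_property_def using maxn_le[of m _ "maxn m _"] by blast
  have assign: "assignment K T ?A"
    unfolding assignment_def by (auto intro!: maxn_in K(1) simp: tuples_def)
  have rule: "interp ?A \<rho> r \<le> interp ?A \<rho> l" if lr: "(l, r) \<in> rules T" and "range \<rho> \<subseteq> K" for l r \<rho>
  proof -
    obtain f ts where l: "l = Fun f ts" "f \<in> defined T" "length ts = arity T f"
        "set ts \<subseteq> terms (constructors T) (arity T)"
      and r: "r \<in> terms (symbols T) (arity T)" and v: "vars r \<subseteq> vars l"
      using T lr unfolding constructor_trs_def by blast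
    have lt: "l \<in> terms (symbols T) (arity T)"
      unfolding l(1) using l(2-4)
      by (intro terms.Fun) (auto simp: symbols_def intro: terms_mono)
    show ?thesis
      using interp_maxn_le[OF lt, of \<rho> "interp ?A \<rho> l"] v l(1)
      unfolding interp_maxn_le[OF r] by auto
  qed
  show "quasi_interpretation K T ?A"
    unfolding quasi_interpretation_def using mono sub assign rule by auto
qed

end

theory Submission
  imports Defs
begin

text \<open>Write \<open>\<alpha>\<close> and \<open>\<beta>\<close> for the additive constants of two unary constructors \<open>S\<close> and \<open>U\<close>. The
  rules for \<open>G\<close> force its slope to be at least \<open>2\<beta> / \<alpha>\<close> and at least \<open>\<alpha> / \<beta>\<close>. The rules for \<open>P\<close>
  trade occurrences of one constructor in the first argument for occurrences of the other in the
  second argument and then apply \<open>G\<close> to move the result back. If the slope of \<open>G\<close> exceeded the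
  exchange rate, this loop could be repeated with ever larger arguments without increasing the
  value of \<open>P\<close>, contradicting the subterm property. Hence the slope is at most \<open>\<alpha> / \<beta>\<close> and at most
  \<open>2\<beta> / \<alpha>\<close>, so that \<open>\<alpha>\<^sup>2 = 2\<beta>\<^sup>2\<close>. This has no positive rational solution, whereas over the reals
  \<open>\<alpha> = \<surd>2\<close>, \<open>\<beta> = 1\<close> works.\<close>

section \<open>The rewrite system\<close>

abbreviation (input) Zero :: "(nat, nat) trm" where "Zero \<equiv> Fun 0 []"
abbreviation (input) S :: "(nat, nat) trm \<Rightarrow> (nat, nat) trm" where "S t \<equiv> Fun 1 [t]"
abbreviation (input) U :: "(nat, nat) trm \<Rightarrow> (nat, nat) trm" where "U t \<equiv> Fun 2 [t]"
abbreviation (input) G :: "(nat, nat) trm \<Rightarrow> (nat, nat) trm" where "G t \<equiv> Fun 3 [t]"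
abbreviation (input) P :: "(nat, nat) trm \<Rightarrow> (nat, nat) trm \<Rightarrow> (nat, nat) trm"
  where "P t u \<equiv> Fun 4 [t, u]"
abbreviation (input) X :: "(nat, nat) trm" where "X \<equiv> Var 0"
abbreviation (input) Y :: "(nat, nat) trm" where "Y \<equiv> Var 1"

text \<open>The doubled \<open>U\<close> in the first and fourth rules brings in the factor 2.
  \<open>Zero\<close> in the last rule gives every round of the loop the same starting
  value.\<close>

definition sqrt2_trs :: "(nat, nat) trs" where
  "sqrt2_trs = \<lparr>constructors = {0, 1, 2}, defined = {3, 4}, arity = (!) [0, 1, 1, 1, 2],
     rules = {(G (S X), U (U (G X))),
              (G (U X), S (G X)),
              (P (S X) Y, P X (U Y)),
              (P (U (U X)) Y, P X (S Y)),
              (P Zero Y, P (G Y) Zero)}\<rparr>"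

lemma sqrt2_trs_simps [simp]:
  "constructors sqrt2_trs = {0, 1, 2}"
  "defined sqrt2_trs = {3, 4}"
  "symbols sqrt2_trs = {0, 1, 2, 3, 4}"
  "arity sqrt2_trs = (!) [0, 1, 1, 1, 2]"
  by (auto simp: sqrt2_trs_def symbols_def)

lemma rules_sqrt2_trs:
  "rules sqrt2_trs = {(G (S X), U (U (G X))), (G (U X), S (G X)), (P (S X) Y, P X (U Y)),
     (P (U (U X)) Y, P X (S Y)), (P Zero Y, P (G Y) Zero)}"
  by (simp add: sqrt2_trs_def)

lemma Fun_in_terms_iff:
  "Fun f ts \<in> terms F ar \<longleftrightarrow> f \<in> F \<and> length ts = ar f \<and> set ts \<subseteq> terms F ar"
  by (subst terms.simps) auto

lemma constructor_sqrt2_trs: "constructor_trs sqrt2_trs"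
  by (simp add: constructor_trs_def rules_sqrt2_trs Fun_in_terms_iff terms.Var)

text \<open>Proper subterms of left-hand sides are variables or have a constructor at the root, and
  rules for the same defined symbol differ in the head of the first argument. So every overlap fails
  by a clash of symbols.\<close>

lemma orthogonal_sqrt2_trs: "orthogonal sqrt2_trs"
  by (simp add: orthogonal_def left_linear_def linear_def non_overlapping_def rules_sqrt2_trs)

section \<open>A real quasi-interpretation\<close>

text \<open>With slope \<open>sqrt 2\<close> for \<open>G\<close> and for the second argument of
  \<open>P\<close>, all five rules hold with equality.\<close>

definition sqrt2_interp :: "nat \<Rightarrow> real list \<Rightarrow> real" where
  "sqrt2_interp f = (if f = 0 then (\<lambda>xs. 0)
     else if f = 1 then (\<lambda>xs. xs ! 0 + sqrt 2)
     else if f = 2 then (\<lambda>xs. xs ! 0 + 1)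
     else if f = 3 then (\<lambda>xs. sqrt 2 * xs ! 0)
     else (\<lambda>xs. xs ! 0 + sqrt 2 * xs ! 1))"

lemma tuples_1: "tuples K (Suc 0) = {[x] | x. x \<in> K}"
  by (auto simp: tuples_def length_Suc_conv)

lemma tuples_2: "tuples K 2 = {[x, y] | x y. x \<in> K \<and> y \<in> K}"
  by (auto simp: tuples_def length_Suc_conv numeral_2_eq_2)

lemma le_sqrt2_mult: "0 \<le> x \<Longrightarrow> x \<le> sqrt 2 * x"
  using mult_right_mono[of 1 "sqrt 2" x] by simp

lemma real_quasi_interpretation:
  "in_max_poly nonneg_reals sqrt2_trs sqrt2_interp"
  "additive_constructors nonneg_reals sqrt2_trs sqrt2_interp"
  "quasi_interpretation nonneg_reals sqrt2_trs sqrt2_interp"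
proof -
  show "in_max_poly nonneg_reals sqrt2_trs sqrt2_interp"
    by (auto simp: in_max_poly_def sqrt2_interp_def nonneg_reals_def intro!: max_poly.intros)
  show "additive_constructors nonneg_reals sqrt2_trs sqrt2_interp"
    by (auto simp: additive_constructors_def sqrt2_interp_def nonneg_reals_def tuples_1
        intro: exI[of _ "sqrt 2"] exI[of _ "1::real"])
  have "assignment nonneg_reals sqrt2_trs sqrt2_interp"
    by (auto simp: assignment_def sqrt2_interp_def nonneg_reals_def tuples_1 tuples_2)
  moreover have "\<forall>g\<in>symbols sqrt2_trs.
      nondecreasing nonneg_reals (arity sqrt2_trs g) (sqrt2_interp g)"
    by (auto simp: nondecreasing_def sqrt2_interp_def tuples_1 tuples_2 less_2_cases_iff)
  moreover have "\<forall>g\<in>symbols sqrt2_trs.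
      subterm_property nonneg_reals (arity sqrt2_trs g) (sqrt2_interp g)"
    by (auto simp: subterm_property_def sqrt2_interp_def tuples_1 tuples_2 less_2_cases_iff
        nonneg_reals_def le_sqrt2_mult intro: add_increasing)
  moreover have "\<forall>(l, r)\<in>rules sqrt2_trs. \<forall>\<rho>. range \<rho> \<subseteq> nonneg_reals \<longrightarrow>
      interp sqrt2_interp \<rho> l \<ge> interp sqrt2_interp \<rho> r"
    by (auto simp: rules_sqrt2_trs sqrt2_interp_def algebra_simps)
  ultimately show "quasi_interpretation nonneg_reals sqrt2_trs sqrt2_interp"
    by (simp add: quasi_interpretation_def)
qed

section \<open>The exchange argument\<close>

text \<open>In the loop described at the top, \<open>g\<close> has slope at least \<open>\<tau> / \<sigma>\<close>, and \<open>\<epsilon>\<close> in the first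
  argument of \<open>p\<close> is exchanged for \<open>\<delta>\<close> in the second.\<close>

lemma exchange_bound:
  fixes g :: "real \<Rightarrow> real" and p :: "real \<Rightarrow> real \<Rightarrow> real"
  assumes K: "\<And>x y. x \<in> K \<Longrightarrow> y \<in> K \<Longrightarrow> x + y \<in> K"
    and in_K: "\<zeta> \<in> K" "\<sigma> \<in> K" "\<delta> \<in> K" "\<epsilon> \<in> K" "\<And>x. x \<in> K \<Longrightarrow> g x \<in> K"
    and pos: "\<zeta> \<ge> 0" "\<sigma> > 0" "\<tau> > 0" "\<delta> > 0" "\<epsilon> > 0"
    and g_mono: "\<And>x y. x \<in> K \<Longrightarrow> y \<in> K \<Longrightarrow> x \<le> y \<Longrightarrow> g x \<le> g y"
    and g_ge: "\<And>x. x \<in> K \<Longrightarrow> x \<le> g x"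
    and p_mono: "\<And>x x' y. x \<in> K \<Longrightarrow> x' \<in> K \<Longrightarrow> y \<in> K \<Longrightarrow> x \<le> x' \<Longrightarrow> p x y \<le> p x' y"
    and p_ge: "\<And>x y. x \<in> K \<Longrightarrow> y \<in> K \<Longrightarrow> x \<le> p x y"
    and g_step: "\<And>x. x \<in> K \<Longrightarrow> g x + \<tau> \<le> g (x + \<sigma>)"
    and p_step: "\<And>x y. x \<in> K \<Longrightarrow> y \<in> K \<Longrightarrow> p x (y + \<delta>) \<le> p (x + \<epsilon>) y"
    and p_back: "\<And>y. y \<in> K \<Longrightarrow> p (g y) \<zeta> \<le> p \<zeta> y"
  shows "\<tau> * \<delta> \<le> \<epsilon> * \<sigma>"
proof (rule ccontr)
  assume "\<not> ?thesis"
  \<comment> \<open>Net gain per unit of \<open>n\<close>: \<open>n\<close> copies of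
    \<open>\<delta>\<close> make room for about \<open>n * \<delta> / \<sigma>\<close> steps of
    \<open>g\<close>, each worth \<open>\<tau>\<close>, at the price
    \<open>n * \<epsilon>\<close>.\<close>
  then have gap: "\<tau> * \<delta> / \<sigma> - \<epsilon> > 0"
    using pos by (simp add: field_simps)
  have add_K: "x + real n * c \<in> K" if "x \<in> K" "c \<in> K" for x c n
  proof (induction n)
    case (Suc n)
    from K[OF Suc that(2)] show ?case by (simp add: algebra_simps)
  qed (simp add: that)
  have g_steps: "\<zeta> + real k * \<tau> \<le> g (\<zeta> + real k * \<sigma>)" for k
  proof (induction k)
    case (Suc k)
    with g_step[OF add_K[OF in_K(1,2), of k]] show ?case
      by (simp add: algebra_simps)
  qed (simp add: g_ge in_K)
  have p_steps: "p x (y + real n * \<delta>) \<le> p (x + real n * \<epsilon>) y" if "x \<in> K" "y \<in> K" for x y n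
    using that(1)
  \<comment> \<open>Each exchange changes the first argument, hence the generalisation over
    \<open>x\<close>.\<close>
  proof (induction n arbitrary: x)
    case (Suc n)
    have "p x ((y + real n * \<delta>) + \<delta>) \<le> p (x + \<epsilon>) (y + real n * \<delta>)"
      by (intro p_step Suc.prems add_K that(2) in_K)
    also have "\<dots> \<le> p (x + \<epsilon> + real n * \<epsilon>) y"
      by (intro Suc.IH K Suc.prems in_K)
    finally show ?case by (simp add: algebra_simps)
  qed simp
  \<comment> \<open>The contradiction: \<open>q\<close> is nonincreasing from some \<open>N\<close>
    on, yet unbounded by \<open>p_ge\<close>.\<close>
  define q where "q n = p (\<zeta> + real n * \<epsilon>) \<zeta>" for n
  \<comment> \<open>The summand \<open>\<tau>\<close> pays for rounding down in \<open>k\<close>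
    below, \<open>\<epsilon>\<close> for passing from \<open>n\<close> to
    \<open>Suc n\<close>.\<close>
  obtain N where N: "real N * (\<tau> * \<delta> / \<sigma> - \<epsilon>) > \<tau> + \<epsilon>"
    using ex_less_of_nat_mult[OF gap] by blast
  have q_Suc: "q (Suc n) \<le> q n" if "n \<ge> N" for n
  proof -
    \<comment> \<open>The number of whole \<open>\<sigma>\<close>-steps of \<open>g\<close> that fit
      into \<open>n * \<delta>\<close>.\<close>
    define k where "k = nat \<lfloor>real n * \<delta> / \<sigma>\<rfloor>"
    have "0 \<le> real n * \<delta> / \<sigma>"
      using pos by simp
    then have k: "real k \<le> real n * \<delta> / \<sigma>" "real n * \<delta> / \<sigma> < real k + 1"
      unfolding k_def by linarith+
    have "real N * (\<tau> * \<delta> / \<sigma> - \<epsilon>) \<le> real n * (\<tau> * \<delta> / \<sigma> - \<epsilon>)"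
      using that gap by (intro mult_right_mono) auto
    with N have "\<tau> + \<epsilon> \<le> real n * (\<tau> * \<delta> / \<sigma> - \<epsilon>)"
      by linarith
    moreover have "(real n * \<delta> / \<sigma>) * \<tau> \<le> (real k + 1) * \<tau>"
      using k(2) pos by (intro mult_right_mono) auto
    ultimately have "\<zeta> + real (Suc n) * \<epsilon> \<le> \<zeta> + real k * \<tau>"
      by (simp add: algebra_simps)
    also have "\<dots> \<le> g (\<zeta> + real k * \<sigma>)"
      by (rule g_steps)
    also have "\<dots> \<le> g (\<zeta> + real n * \<delta>)"
      using k(1) pos by (intro g_mono add_K in_K) (simp add: field_simps)
    finally have "q (Suc n) \<le> p (g (\<zeta> + real n * \<delta>)) \<zeta>"
      unfolding q_def by (intro p_mono add_K in_K)
    also have "\<dots> \<le> p \<zeta> (\<zeta> + real n * \<delta>)"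
      by (intro p_back add_K in_K)
    also have "\<dots> \<le> q n"
      unfolding q_def by (intro p_steps in_K)
    finally show ?thesis .
  qed
  have q_le: "q (N + j) \<le> q N" for j
  proof (induction j)
    case (Suc j)
    with q_Suc[of "N + j"] show ?case by simp
  qed simp
  \<comment> \<open>By \<open>p_ge\<close>, \<open>q (N + j)\<close> is at least
    \<open>j * \<epsilon>\<close>, so this \<open>j\<close> contradicts \<open>q_le\<close>.\<close>
  obtain j where j: "real j * \<epsilon> > q N"
    using ex_less_of_nat_mult[OF pos(5)] by blast
  have "real j * \<epsilon> \<le> \<zeta> + real (N + j) * \<epsilon>"
    using pos by (simp add: algebra_simps)
  also have "\<dots> \<le> q (N + j)"
    unfolding q_def by (intro p_ge add_K in_K)
  also note q_le
  finally show False using j by simp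
qed

section \<open>Constraints on the constructor constants\<close>

text \<open>Pairing the first \<open>G\<close> rule with the first \<open>P\<close> rule, and the
  second with the second, \<open>exchange_bound\<close> yields opposite inequalities between
  \<open>\<alpha>\<^sup>2\<close> and \<open>2 * \<beta>\<^sup>2\<close>.\<close>

lemma sqrt2_trs_forces_sqrt2:
  assumes K: "\<And>x y. x \<in> K \<Longrightarrow> y \<in> K \<Longrightarrow> x + y \<in> K" "\<And>x. x \<in> K \<Longrightarrow> 0 \<le> x"
    and add: "additive_constructors K sqrt2_trs A"
    and qi: "quasi_interpretation K sqrt2_trs A"
  shows "\<exists>\<alpha>\<in>K. \<exists>\<beta>\<in>K. 1 \<le> \<beta> \<and> \<alpha>\<^sup>2 = 2 * \<beta>\<^sup>2"
proof -
  obtain \<alpha> where \<alpha>: "\<alpha> \<in> K" "1 \<le> \<alpha>" "\<And>x. x \<in> K \<Longrightarrow> A 1 [x] = x + \<alpha>"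
    using add by (fastforce simp: additive_constructors_def tuples_1)
  obtain \<beta> where \<beta>: "\<beta> \<in> K" "1 \<le> \<beta>" "\<And>x. x \<in> K \<Longrightarrow> A 2 [x] = x + \<beta>"
    using add by (fastforce simp: additive_constructors_def tuples_1)
  define \<zeta> where "\<zeta> = A 0 []"
  define g where "g x = A 3 [x]" for x
  define p where "p x y = A 4 [x, y]" for x y
  have \<zeta>: "\<zeta> \<in> K" and g_in: "\<And>x. x \<in> K \<Longrightarrow> g x \<in> K"
    using qi by (auto simp: quasi_interpretation_def assignment_def tuples_1 tuples_def
        \<zeta>_def g_def)
  have g_mono: "g x \<le> g y" if "x \<in> K" "y \<in> K" "x \<le> y" for x y
  proof -
    have "nondecreasing K 1 (A 3)"
      using qi by (simp add: quasi_interpretation_def)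
    with that show ?thesis by (force simp: nondecreasing_def tuples_1 g_def)
  qed
  have p_mono: "p x y \<le> p x' y" if "x \<in> K" "x' \<in> K" "y \<in> K" "x \<le> x'" for x x' y
  proof -
    have "nondecreasing K 2 (A 4)"
      using qi by (simp add: quasi_interpretation_def)
    then have "A 4 [x, y] \<le> A 4 ([x, y][0 := x'])"
      unfolding nondecreasing_def using that by (force simp: tuples_2)
    then show ?thesis by (simp add: p_def)
  qed
  have g_ge: "x \<le> g x" if "x \<in> K" for x
  proof -
    have "subterm_property K 1 (A 3)"
      using qi by (simp add: quasi_interpretation_def)
    with that show ?thesis by (force simp: subterm_property_def tuples_1 g_def)
  qed
  have p_ge: "x \<le> p x y" if "x \<in> K" "y \<in> K" for x y
  proof -
    have "subterm_property K 2 (A 4)"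
      using qi by (simp add: quasi_interpretation_def)
    with that show ?thesis by (force simp: subterm_property_def tuples_2 p_def)
  qed
  have rule: "interp A \<rho> r \<le> interp A \<rho> l" if "(l, r) \<in> rules sqrt2_trs" "range \<rho> \<subseteq> K" for l r \<rho>
    using qi that by (auto simp: quasi_interpretation_def)
  have rules: "g x + 2 * \<beta> \<le> g (x + \<alpha>)" "g x + \<alpha> \<le> g (x + \<beta>)"
      "p x (y + \<beta>) \<le> p (x + \<alpha>) y" "p x (y + \<alpha>) \<le> p (x + 2 * \<beta>) y" "p (g y) \<zeta> \<le> p \<zeta> y"
    if "x \<in> K" "y \<in> K" for x y
  proof -
    define \<rho> where "\<rho> v = (if v = 0 then x else y)" for v :: nat
    have \<rho>: "range \<rho> \<subseteq> K"
      using that by (auto simp: \<rho>_def)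
    note simps = \<rho>_def that K \<alpha> \<beta> g_in \<zeta>_def[symmetric] g_def[symmetric] p_def[symmetric]
    show "g x + 2 * \<beta> \<le> g (x + \<alpha>)"
      using rule[of "G (S X)" "U (U (G X))", OF _ \<rho>]
      \<comment> \<open>The simplifier turns the symbol \<open>1\<close> into \<open>Suc 0\<close>,
        so the equation for \<open>S\<close> must be supplied in that form.\<close>
      by (simp add: rules_sqrt2_trs simps \<alpha>(3)[unfolded One_nat_def])
    show "g x + \<alpha> \<le> g (x + \<beta>)"
      using rule[of "G (U X)" "S (G X)", OF _ \<rho>]
      by (simp add: rules_sqrt2_trs simps \<alpha>(3)[unfolded One_nat_def])
    show "p x (y + \<beta>) \<le> p (x + \<alpha>) y"
      using rule[of "P (S X) Y" "P X (U Y)", OF _ \<rho>]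
      by (simp add: rules_sqrt2_trs simps \<alpha>(3)[unfolded One_nat_def])
    show "p x (y + \<alpha>) \<le> p (x + 2 * \<beta>) y"
      using rule[of "P (U (U X)) Y" "P X (S Y)", OF _ \<rho>]
      by (simp add: rules_sqrt2_trs simps \<alpha>(3)[unfolded One_nat_def] add.assoc)
    show "p (g y) \<zeta> \<le> p \<zeta> y"
      using rule[of "P Zero Y" "P (G Y) Zero", OF _ \<rho>]
      by (simp add: rules_sqrt2_trs simps)
  qed
  have two_\<beta>: "2 * \<beta> \<in> K"
    using K(1)[OF \<beta>(1) \<beta>(1)] by simp
  \<comment> \<open>Here \<open>\<tau> = 2 * \<beta>\<close>, \<open>\<sigma> = \<alpha>\<close>,
    \<open>\<delta> = \<beta>\<close>, \<open>\<epsilon> = \<alpha>\<close>.\<close>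
  have "(2 * \<beta>) * \<beta> \<le> \<alpha> * \<alpha>"
    by (rule exchange_bound[where K = K and g = g and p = p and \<zeta> = \<zeta>])
      (use K \<zeta> \<alpha> \<beta> g_in g_mono g_ge p_mono p_ge rules in auto)
  \<comment> \<open>Here \<open>\<tau> = \<alpha>\<close>, \<open>\<sigma> = \<beta>\<close>,
    \<open>\<delta> = \<alpha>\<close>, \<open>\<epsilon> = 2 * \<beta>\<close>.\<close>
  moreover have "\<alpha> * \<alpha> \<le> (2 * \<beta>) * \<beta>"
    by (rule exchange_bound[where K = K and g = g and p = p and \<zeta> = \<zeta>])
      (use K \<zeta> \<alpha> \<beta> two_\<beta> g_in g_mono g_ge p_mono p_ge rules in auto)
  ultimately have "\<alpha>\<^sup>2 = 2 * \<beta>\<^sup>2"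
    by (simp add: power2_eq_square)
  with \<alpha> \<beta> show ?thesis by blast
qed

section \<open>Irrationality of the square root of 2\<close>

text \<open>Infinite descent: \<open>m\<close> is even, say \<open>2 * k\<close>, and then
  \<open>(n, k)\<close> is a solution with \<open>k < n\<close>.\<close>

lemma nat_square_eq_two_squares:
  fixes m n :: nat
  assumes "m\<^sup>2 = 2 * n\<^sup>2"
  shows "n = 0"
  using assms
proof (induction n arbitrary: m rule: less_induct)
  case (less n)
  show ?case
  proof (rule ccontr)
    assume "n \<noteq> 0"
    have "even (m\<^sup>2)" by (simp add: less.prems)
    then obtain k where m: "m = 2 * k" by auto
    with less.prems have n: "n\<^sup>2 = 2 * k\<^sup>2" by (simp add: power2_eq_square)
    have "k < n"
    proof (rule ccontr)
      assume "\<not> k < n"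
      then have "n\<^sup>2 \<le> k\<^sup>2" by (simp add: power_mono)
      with n \<open>n \<noteq> 0\<close> show False by simp
    qed
    with less.IH n have "k = 0" by blast
    with n \<open>n \<noteq> 0\<close> show False by simp
  qed
qed

lemma rat_square_eq_two_squares:
  fixes x y :: real
  assumes "x \<in> \<rat>" "y \<in> \<rat>" "x\<^sup>2 = 2 * y\<^sup>2"
  shows "y = 0"
proof (rule ccontr)
  assume "y \<noteq> 0"
  have "x / y \<in> \<rat>" using assms by simp
  \<comment> \<open>Passing to the absolute value allows natural numbers; the sign vanishes on
    squaring.\<close>
  then obtain m n :: nat where n: "n \<noteq> 0" and mn: "\<bar>x / y\<bar> = real m / real n"
    using Rats_abs_nat_div_natE by metis
  have "(real m)\<^sup>2 / (real n)\<^sup>2 = (x / y)\<^sup>2"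
    by (metis mn power2_abs power_divide)
  also have "\<dots> = 2"
    using assms(3) \<open>y \<noteq> 0\<close> by (simp add: power_divide)
  finally have "(real m)\<^sup>2 = 2 * (real n)\<^sup>2"
    using n by (simp add: field_simps)
  then have "real (m\<^sup>2) = real (2 * n\<^sup>2)"
    by simp
  then have "m\<^sup>2 = 2 * n\<^sup>2"
    by (simp only: of_nat_eq_iff)
  with n nat_square_eq_two_squares show False by blast
qed

theorem theorem17:
  "\<exists>T :: (nat, nat) trs.
     constructor_trs T \<and> orthogonal T \<and>
     (\<exists>A. in_max_poly nonneg_reals T A \<and> additive_constructors nonneg_reals T A \<and>
          quasi_interpretation nonneg_reals T A) \<and>
     \<not> (\<exists>A. in_max_poly nonneg_rats T A \<and> additive_constructors nonneg_rats T A \<and>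
            quasi_interpretation nonneg_rats T A)"
proof (intro exI[of _ sqrt2_trs] conjI notI)
  assume "\<exists>A. in_max_poly nonneg_rats sqrt2_trs A \<and> additive_constructors nonneg_rats sqrt2_trs A \<and>
            quasi_interpretation nonneg_rats sqrt2_trs A"
  then obtain A where A: "additive_constructors nonneg_rats sqrt2_trs A"
      "quasi_interpretation nonneg_rats sqrt2_trs A"
    by blast
  have "\<exists>\<alpha>\<in>nonneg_rats. \<exists>\<beta>\<in>nonneg_rats. 1 \<le> \<beta> \<and> \<alpha>\<^sup>2 = 2 * \<beta>\<^sup>2"
    by (rule sqrt2_trs_forces_sqrt2[OF _ _ A]) (simp_all add: nonneg_rats_def)
  then obtain \<alpha> \<beta> :: real where "\<alpha> \<in> \<rat>" "\<beta> \<in> \<rat>" "1 \<le> \<beta>" "\<alpha>\<^sup>2 = 2 * \<beta>\<^sup>2"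
    by (auto simp: nonneg_rats_def)
  with rat_square_eq_two_squares[of \<alpha> \<beta>] show False by simp
qed (use constructor_sqrt2_trs orthogonal_sqrt2_trs real_quasi_interpretation in auto)

end
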